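(* Let $\mathbf p\in\mathbb P(\mathcal X)$, let a discrete source with alphabet $\mathcal X$ generate symbols independently according to $\mathbf p$, and let $\alpha\in[0,1)$. Let $\mathcal H(\mathbf w_\alpha)=\lim_{n\to\infty}\frac1n\mathbb H(w_\alpha(x^n))$ be the entropy rate defined in the context. Then: (i) By encoding, with a uniquely decodable code, sufficiently long sequences of $n$ source symbols, the maximum and average length pay-off per source symbol $\frac1n\mathbb L^n_\alpha(\mathbf l,\mathbf p)$ can be made arbitrarily close to $\mathcal H(\mathbf w_\alpha)$: for every $\varepsilon>0$ there is $N$ such that for every $n\ge N$ there is a uniquely decodable $D$-ary code on $\mathcal X^n$ with length function $\mathbf l$ satisfying $\big|\frac1n\mathbb L^n_\alpha(\mathbf l,\mathbf p)-\mathcal H(\mathbf w_\alpha)\big|<\varepsilon$. (ii) It is not possible to find a uniquely decodable code whose pay-off per source symbol is less than the entropy rate: for every $n\ge1$ and every uniquely decodable $D$-ary code on $\mathcal X^n$ with length function $\mathbf l$, $\frac1n\mathbb L^n_\alpha(\mathbf l,\mathbf p)\ge\mathcal H(\mathbf w_\alpha)$.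
   Context: Let $D\ge 2$ be an integer and $\log=\log_D$. Let $\mathcal X=\{x_1,\dots,x_{|\mathcal X|}\}$ be a finite alphabet and let $\mathbb P(\mathcal X)$ be the set of probability vectors $\mathbf p=(p(x_1),\dots,p(x_{|\mathcal X|}))$ with $p(x_1)\ge\dots\ge p(x_{|\mathcal X|})>0$ and $\sum_x p(x)=1$. For $n\ge1$ and $x^n=(x_{i_1},\dots,x_{i_n})\in\mathcal X^n$ put $p(x^n)=\prod_{j=1}^n p(x_{i_j})$. For a length function $\mathbf l:\mathcal X^n\to[0,\infty)$, $$\mathbb L^n_\alpha(\mathbf l,\mathbf p)=\alpha\max_{x^n\in\mathcal X^n}l(x^n)+(1-\alpha)\sum_{x^n\in\mathcal X^n}l(x^n)p(x^n).$$ A uniquely decodable $D$-ary code on $\mathcal X^n$ assigns to each $x^n$ a finite word over $\{0,\dots,D-1\}$ so that distinct finite sequences of elements of $\mathcal X^n$ have distinct concatenated encodings; its length function gives the codeword lengths (integers). The weights: let $\mathbf l^\dagger$ be the minimizer of $\mathbb L^n_\alpha(\cdot,\mathbf p)$ over real-valued $\mathbf l:\mathcal X^n\to[0,\infty)$ with $\sum_{x^n}D^{-l(x^n)}\le1$, let $\mathcal U^n=\{x^n: l^\dagger(x^n)=\max_{y^n} l^\dagger(y^n)\}$ and $\mathcal U^{n,c}=\mathcal X^n\setminus\mathcal U^n$. Then $w_\alpha(x^n)=(1-\alpha)p(x^n)$ for $x^n\in\mathcal U^{n,c}$ and $w_\alpha(x^n)=\frac{1}{|\mathcal U^n|}\big(\alpha+(1-\alpha)\sum_{y^n\in\mathcal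 U^n}p(y^n)\big)$ for $x^n\in\mathcal U^n$; this is a probability vector on $\mathcal X^n$ (and equals $D^{-l^\dagger(x^n)}$). $\mathbb H(w_\alpha(x^n))=-\sum_{x^n\in\mathcal X^n}w_\alpha(x^n)\log w_\alpha(x^n)$ is its entropy, and the entropy rate is $\mathcal H(\mathbf w_\alpha)=\lim_{n\to\infty}\frac1n\mathbb H(w_\alpha(x^n))$. *)

theory Defs
  imports Complex_Main "HOL-Library.FuncSet"
begin

text \<open>
  The alphabet \<open>{x_1, ..., x_K}\<close> is given by the list \<open>xs = [x_1, ..., x_K]\<close> of its
  (distinct) symbols, so that the ordering convention on the probabilities can be expressed.
\<close>

definition prob_vectors :: "'a list \<Rightarrow> ('a \<Rightarrow> real) set" where
  "prob_vectors xs =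
     {p. sorted_wrt (\<ge>) (map p xs) \<and> (\<forall>x\<in>set xs. p x > 0) \<and> (\<Sum>x\<in>set xs. p x) = 1}"

definition source_seqs :: "'a set \<Rightarrow> nat \<Rightarrow> 'a list set" where
  "source_seqs X n = {u \<in> lists X. length u = n}"

definition seq_prob :: "('a \<Rightarrow> real) \<Rightarrow> 'a list \<Rightarrow> real" where
  "seq_prob p u = (\<Prod>x\<leftarrow>u. p x)"

definition payoff :: "real \<Rightarrow> 'a set \<Rightarrow> ('a \<Rightarrow> real) \<Rightarrow> nat \<Rightarrow> ('a list \<Rightarrow> real) \<Rightarrow> real" where
  "payoff \<alpha> X p n l =
     \<alpha> * Max (l ` source_seqs X n) + (1 - \<alpha>) * (\<Sum>u\<in>source_seqs X n. l u * seq_prob p u)"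

text \<open>
  Length functions are extensional (\<open>undefined\<close> off the source sequences), so that they are
  determined by their values on source sequences and one may speak of \<^emph>\<open>the\<close> minimizer.
\<close>

definition kraft_lengths :: "nat \<Rightarrow> 'a set \<Rightarrow> nat \<Rightarrow> ('a list \<Rightarrow> real) set" where
  "kraft_lengths D X n =
     {l \<in> source_seqs X n \<rightarrow>\<^sub>E {0..}. (\<Sum>u\<in>source_seqs X n. real D powr (- l u)) \<le> 1}"

definition opt_length ::
    "nat \<Rightarrow> real \<Rightarrow> 'a set \<Rightarrow> ('a \<Rightarrow> real) \<Rightarrow> nat \<Rightarrow> 'a list \<Rightarrow> real" where
  "opt_length D \<alpha> X p n =
     (THE l. is_arg_min (payoff \<alpha> X p n) (\<lambda>l. l \<in> kraft_lengths D X n) l)"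

definition max_length_seqs ::
    "nat \<Rightarrow> real \<Rightarrow> 'a set \<Rightarrow> ('a \<Rightarrow> real) \<Rightarrow> nat \<Rightarrow> 'a list set" where
  "max_length_seqs D \<alpha> X p n =
     {u \<in> source_seqs X n. opt_length D \<alpha> X p n u = Max (opt_length D \<alpha> X p n ` source_seqs X n)}"

text \<open>Only the values on \<open>source_seqs X n\<close> are meaningful.\<close>

definition weight ::
    "nat \<Rightarrow> real \<Rightarrow> 'a set \<Rightarrow> ('a \<Rightarrow> real) \<Rightarrow> nat \<Rightarrow> 'a list \<Rightarrow> real" where
  "weight D \<alpha> X p n u =
     (let U = max_length_seqs D \<alpha> X p n in
      if u \<in> U then (\<alpha> + (1 - \<alpha>) * (\<Sum>v\<in>U. seq_prob p v)) / real (card U)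
      else (1 - \<alpha>) * seq_prob p u)"

definition weight_entropy :: "nat \<Rightarrow> real \<Rightarrow> 'a set \<Rightarrow> ('a \<Rightarrow> real) \<Rightarrow> nat \<Rightarrow> real" where
  "weight_entropy D \<alpha> X p n =
     - (\<Sum>u\<in>source_seqs X n. weight D \<alpha> X p n u * log (real D) (weight D \<alpha> X p n u))"

definition entropy_rate :: "nat \<Rightarrow> real \<Rightarrow> 'a set \<Rightarrow> ('a \<Rightarrow> real) \<Rightarrow> real" where
  "entropy_rate D \<alpha> X p = lim (\<lambda>n. weight_entropy D \<alpha> X p n / real n)"

definition uniquely_decodable :: "nat \<Rightarrow> 'b set \<Rightarrow> ('b \<Rightarrow> nat list) \<Rightarrow> bool" where
  "uniquely_decodable D A c \<longleftrightarrow>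
     c \<in> A \<rightarrow> lists {..<D} \<and> inj_on (\<lambda>s. concat (map c s)) (lists A)"

end

theory Submission
  imports Defs "HOL-Library.Sublist"
begin

text \<open>
  The optimal real-valued lengths satisfy \<open>l = - log w\<close> and have payoff exactly the weight entropy,
  so the weight entropy is the minimal payoff under the Kraft inequality. As such it is
  subadditive in the block length, hence its rate converges to the infimum of the normalized
  values; the McMillan inequality gives the lower bound for codes, and rounding up costs only a
  constant.
\<close>

section \<open>Source sequences and their product probabilities\<close>

lemma finite_source_seqs: "finite X \<Longrightarrow> finite (source_seqs X n)"
  unfolding source_seqs_def lists_eq_set using finite_lists_length_eq[of X n] by simp

lemma card_source_seqs: "finite X \<Longrightarrow> card (source_seqs X n) = card X ^ n"
  unfolding source_seqs_def lists_eq_set using card_lists_length_eq[of X n] by simp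

lemma source_seqs_nonempty: "X \<noteq> {} \<Longrightarrow> source_seqs X n \<noteq> {}"
proof -
  assume "X \<noteq> {}"
  then obtain x where "x \<in> X" by auto
  then have "replicate n x \<in> source_seqs X n" by (auto simp: source_seqs_def)
  then show ?thesis by auto
qed

lemma bij_betw_append_source_seqs:
  "bij_betw (\<lambda>(u, v). u @ v) (source_seqs X m \<times> source_seqs X n) (source_seqs X (m + n))"
  by (rule bij_betw_byWitness[where f' = "\<lambda>w. (take m w, drop m w)"])
    (auto simp: source_seqs_def lists_eq_set dest: in_set_takeD in_set_dropD)

lemma sum_source_seqs_add:
  "(\<Sum>w\<in>source_seqs X (m + n). f w) =
    (\<Sum>u\<in>source_seqs X m. \<Sum>v\<in>source_seqs X n. f (u @ v))"
  unfolding sum.cartesian_product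
  using sum.reindex_bij_betw[OF bij_betw_append_source_seqs[of X m n], of f]
  by (simp add: case_prod_unfold)

lemma source_seqs_0: "source_seqs X 0 = {[]}"
  by (auto simp: source_seqs_def)

lemma source_seqs_1: "source_seqs X (Suc 0) = (\<lambda>x. [x]) ` X"
  by (auto simp: source_seqs_def length_Suc_conv)

text \<open>Expanding the power by distributivity gives one summand per block. This yields total
  probability one for blocks and, later, the expansion of a power of the Kraft sum.\<close>

lemma sum_prod_list_source_seqs:
  fixes f :: "'a \<Rightarrow> 'b :: comm_semiring_1"
  shows "(\<Sum>u\<in>source_seqs X n. \<Prod>x\<leftarrow>u. f x) = (\<Sum>x\<in>X. f x) ^ n"
proof (induction n)
  case 0
  then show ?case by (simp add: source_seqs_0)
next
  case (Suc n)
  have "(\<Sum>u\<in>source_seqs X (Suc 0 + n). \<Prod>x\<leftarrow>u. f x)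
      = (\<Sum>u\<in>source_seqs X (Suc 0). \<Prod>x\<leftarrow>u. f x) * (\<Sum>v\<in>source_seqs X n. \<Prod>x\<leftarrow>v. f x)"
    unfolding sum_source_seqs_add by (simp add: sum_product)
  also have "(\<Sum>u\<in>source_seqs X (Suc 0). \<Prod>x\<leftarrow>u. f x) = (\<Sum>x\<in>X. f x)"
    unfolding source_seqs_1 by (subst sum.reindex) (auto simp: inj_on_def)
  finally show ?case using Suc by simp
qed

lemma sum_seq_prob: "(\<Sum>x\<in>X. p x) = 1 \<Longrightarrow> (\<Sum>u\<in>source_seqs X n. seq_prob p u) = 1"
  by (simp add: seq_prob_def sum_prod_list_source_seqs)

lemma seq_prob_pos:
  assumes "\<And>x. x \<in> X \<Longrightarrow> p x > 0" "u \<in> source_seqs X n"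
  shows "seq_prob p u > 0"
proof -
  have "set u \<subseteq> X" using assms(2) by (auto simp: source_seqs_def)
  then show ?thesis
    unfolding seq_prob_def using assms(1) by (induction u) auto
qed

lemma seq_prob_append: "seq_prob p (u @ v) = seq_prob p u * seq_prob p v"
  by (simp add: seq_prob_def)


subsection \<open>The Kraft--McMillan inequality and its converse\<close>

text \<open>Exponential growth beats linear growth: for \<open>K > 1\<close>, multiplying the bound
  by \<open>(1 / K) ^ k\<close> leaves \<open>1\<close> on the left and a null sequence on the
  right.\<close>

lemma le_1_if_powers_linearly_bounded:
  fixes K B :: real
  assumes "\<And>k. K ^ k \<le> real k * B + 1"
  shows "K \<le> 1"
proof (rule ccontr)
  assume "\<not> K \<le> 1"
  then have K: "K > 1" by simp
  define x where "x = 1 / K"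
  have x: "0 < x" "x < 1" using K by (auto simp: x_def)
  have "(\<lambda>k. (real k * x ^ k) * B + x ^ k) \<longlonglongrightarrow> 0 * B + 0"
    using x powser_times_n_limit_0[of x] LIMSEQ_power_zero[of x] by (intro tendsto_intros) auto
  moreover have "1 \<le> (real k * x ^ k) * B + x ^ k" for k
  proof -
    have "1 = K ^ k * x ^ k" using K by (simp add: x_def power_divide)
    also have "\<dots> \<le> (real k * B + 1) * x ^ k"
      using assms x by (intro mult_right_mono) auto
    finally show ?thesis by (simp add: algebra_simps)
  qed
  ultimately have "(1::real) \<le> 0 * B + 0"
    by (intro LIMSEQ_le_const[of "\<lambda>k. (real k * x ^ k) * B + x ^ k"]) auto
  then show False by simp
qed

text \<open>McMillan's power trick: the \<open>k\<close>-th power of the Kraft sum runs over the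
  encodings of \<open>k\<close>-blocks. Unique decodability makes these distinct words of length at
  most \<open>k * L\<close>, and all \<open>D\<close>-ary words of one given length together
  contribute \<open>1\<close>, so the power grows at most linearly in \<open>k\<close>.\<close>

theorem kraft_mcmillan:
  assumes D: "D \<ge> 1" and A: "finite A" and c: "uniquely_decodable D A c"
  shows "(\<Sum>a\<in>A. (1 / real D) ^ length (c a)) \<le> 1"
proof (rule le_1_if_powers_linearly_bounded)
  fix k
  \<comment> \<open>\<open>0\<close> is inserted so that \<open>Max\<close> also makes sense for
    empty \<open>A\<close>.\<close>
  define L where "L = Max (insert 0 ((\<lambda>a. length (c a)) ` A))"
  define e where "e = (\<lambda>s. concat (map c s))"
  define r where "r = 1 / real D"
  let ?S = "source_seqs A k"
  have r: "r \<ge> 0" by (simp add: r_def)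
  have le_L: "length (c a) \<le> L" if "a \<in> A" for a
    unfolding L_def using A that by (intro Max_ge) auto
  have len_e: "length (e s) \<le> length s * L" if "set s \<subseteq> A" for s
    using that by (induction s) (auto simp: e_def intro!: add_mono le_L)
  have word_e: "set (e s) \<subseteq> {..<D}" if "set s \<subseteq> A" for s
    using that c by (auto simp: e_def uniquely_decodable_def lists_eq_set Pi_def)
  have inj: "inj_on e ?S"
    using c unfolding uniquely_decodable_def e_def
    by (auto simp: source_seqs_def intro: inj_on_subset)
  have sub: "e ` ?S \<subseteq> (\<Union>m\<in>{..k * L}. source_seqs {..<D} m)"
  proof
    fix w assume "w \<in> e ` ?S"
    then obtain s where "w = e s" "set s \<subseteq> A" "length s = k" by (auto simp: source_seqs_def)
    then show "w \<in> (\<Union>m\<in>{..k * L}. source_seqs {..<D} m)"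
      using len_e[of s] word_e[of s] by (auto simp: source_seqs_def)
  qed
  have "(\<Sum>a\<in>A. r ^ length (c a)) ^ k = (\<Sum>s\<in>?S. \<Prod>a\<leftarrow>s. r ^ length (c a))"
    by (simp add: sum_prod_list_source_seqs)
  also have "\<dots> = (\<Sum>s\<in>?S. r ^ length (e s))"
  proof (rule sum.cong)
    fix s show "(\<Prod>a\<leftarrow>s. r ^ length (c a)) = r ^ length (e s)"
      by (induction s) (auto simp: e_def power_add)
  qed simp
  also have "\<dots> = (\<Sum>w\<in>e ` ?S. r ^ length w)"
    by (simp add: sum.reindex[OF inj])
  also have "\<dots> \<le> (\<Sum>w\<in>(\<Union>m\<in>{..k * L}. source_seqs {..<D} m). r ^ length w)"
    using sub r by (intro sum_mono2) (auto simp: finite_source_seqs)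
  also have "\<dots> = (\<Sum>m\<in>{..k * L}. \<Sum>w\<in>source_seqs {..<D} m. r ^ length w)"
    by (intro sum.UNION_disjoint ballI finite_source_seqs) (auto simp: source_seqs_def)
  also have "\<dots> = (\<Sum>m\<in>{..k * L}. 1)"
  proof (rule sum.cong)
    fix m
    have "(\<Sum>w\<in>source_seqs {..<D} m. r ^ length w) = (\<Sum>w\<in>source_seqs {..<D} m. r ^ m)"
      by (rule sum.cong) (auto simp: source_seqs_def)
    also have "\<dots> = 1"
      using D by (simp add: card_source_seqs r_def power_divide)
    finally show "(\<Sum>w\<in>source_seqs {..<D} m. r ^ length w) = 1" .
  qed simp
  also have "\<dots> = real k * real L + 1" by simp
  finally show "(\<Sum>a\<in>A. (1 / real D) ^ length (c a)) ^ k \<le> real k * real L + 1"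
    by (simp add: r_def)
qed

text \<open>Since a word is a prefix of itself, this includes injectivity of \<open>c\<close> on
  \<open>A\<close>.\<close>

definition prefix_free_on :: "'b set \<Rightarrow> ('b \<Rightarrow> 'c list) \<Rightarrow> bool" where
  "prefix_free_on A c \<longleftrightarrow> (\<forall>a\<in>A. \<forall>b\<in>A. prefix (c a) (c b) \<longrightarrow> a = b)"

text \<open>Decoding runs from the left: the first codewords of two equal concatenations are
  prefixes of the same word, hence comparable, hence equal symbols. Nonempty words exclude a single
  symbol coded by \<open>[]\<close>, which is prefix-free but not decodable.\<close>

lemma uniquely_decodable_if_prefix_free:
  assumes words: "c \<in> A \<rightarrow> lists {..<D}" and ne: "\<And>a. a \<in> A \<Longrightarrow> c a \<noteq> []"
    and pf: "prefix_free_on A c"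
  shows "uniquely_decodable D A c"
proof -
  have "s = t" if "set s \<subseteq> A" "set t \<subseteq> A" "concat (map c s) = concat (map c t)" for s t
    using that
  proof (induction s arbitrary: t)
    case Nil
    then show ?case using ne by (cases t) auto
  next
    case (Cons a s)
    show ?case
    proof (cases t)
      case Nil
      then show ?thesis using Cons.prems ne by auto
    next
      case t: (Cons b t')
      have eq: "c a @ concat (map c s) = c b @ concat (map c t')"
        using Cons.prems t by simp
      then have "prefix (c a) (c b) \<or> prefix (c b) (c a)"
        by (metis prefixI prefix_same_cases)
      then have "a = b"
        using pf Cons.prems t by (auto simp: prefix_free_on_def)
      then show ?thesis using eq Cons t by auto
    qed
  qed
  then show ?thesis
    unfolding uniquely_decodable_def using words by (auto simp: inj_on_def lists_eq_set)
qed

text \<open>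
  The longest codeword is chosen last: the words of its length extending one of the other
  codewords are too few to exhaust all words of that length.
\<close>

theorem kraft_converse:
  assumes D: "D \<ge> 1" and A: "finite A" and K: "(\<Sum>a\<in>A. (1 / real D) ^ l a) \<le> 1"
  obtains c where "c \<in> A \<rightarrow> lists {..<D}" "\<And>a. a \<in> A \<Longrightarrow> length (c a) = l a"
    "prefix_free_on A c"
proof -
  have "\<exists>c. c \<in> A \<rightarrow> lists {..<D} \<and> (\<forall>a\<in>A. length (c a) = l a) \<and> prefix_free_on A c"
    using A K
  proof (induction "card A" arbitrary: A)
    case 0
    then show ?case by (auto simp: prefix_free_on_def)
  next
    case (Suc k)
    have "A \<noteq> {}" using Suc.hyps(2) by auto
    then have "Max (l ` A) \<in> l ` A" using Suc.prems(1) by (intro Max_in) auto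
    then obtain a where a: "a \<in> A" "l a = Max (l ` A)" by auto
    have amax: "l b \<le> l a" if "b \<in> A" for b
      using a that Suc.prems(1) by (metis Max_ge finite_imageI image_eqI)
    define B where "B = A - {a}"
    have fB: "finite B" and aB: "a \<notin> B" and AB: "A = insert a B"
      using Suc.prems(1) a(1) by (auto simp: B_def)
    have KA: "(1 / real D) ^ l a + (\<Sum>b\<in>B. (1 / real D) ^ l b) \<le> 1"
      using Suc.prems(2) fB aB AB by simp
    have "(\<Sum>b\<in>B. (1 / real D) ^ l b) \<le> 1"
      by (rule order.trans[OF _ KA]) simp
    moreover have "k = card B" using Suc.hyps(2) fB aB AB by simp
    ultimately obtain c where c: "c \<in> B \<rightarrow> lists {..<D}" "\<forall>b\<in>B. length (c b) = l b"
      "prefix_free_on B c"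
      using Suc.hyps(1)[of B] fB by blast
    \<comment> \<open>\<open>E b\<close> is the set of words of length \<open>l a\<close> extending
      \<open>c b\<close>; the subtraction is exact because \<open>l a\<close> is maximal.\<close>
    define E where "E = (\<lambda>b. (\<lambda>v. c b @ v) ` source_seqs {..<D} (l a - l b))"
    have cardE: "real (card (E b)) = real D ^ l a * (1 / real D) ^ l b" if "b \<in> B" for b
    proof -
      have "card (E b) = D ^ (l a - l b)"
        unfolding E_def by (subst card_image) (auto simp: inj_on_def card_source_seqs)
      then have "real (card (E b)) = real D ^ (l a - l b)" by simp
      also have "\<dots> = real D ^ l a * (1 / real D) ^ l b"
        using amax[of b] that AB D by (simp add: power_diff power_divide)
      finally show ?thesis .
    qed
    have "real (card (\<Union>b\<in>B. E b)) \<le> real (\<Sum>b\<in>B. card (E b))"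
      using card_UN_le[OF fB, of E] by (simp only: of_nat_le_iff)
    also have "\<dots> = real D ^ l a * (\<Sum>b\<in>B. (1 / real D) ^ l b)"
      using cardE by (simp add: sum_distrib_left)
    \<comment> \<open>The positive Kraft summand of \<open>a\<close> itself leaves at least one word
      of length \<open>l a\<close> uncovered.\<close>
    also have "\<dots> \<le> real D ^ l a * (1 - (1 / real D) ^ l a)"
      using KA by (intro mult_left_mono) auto
    also have "\<dots> < real D ^ l a"
      using D by simp
    finally have less: "card (\<Union>b\<in>B. E b) < card (source_seqs {..<D} (l a))"
      by (simp add: card_source_seqs flip: of_nat_power)
    have "finite (\<Union>b\<in>B. E b)" using fB by (auto simp: E_def finite_source_seqs)
    then have "\<not> source_seqs {..<D} (l a) \<subseteq> (\<Union>b\<in>B. E b)"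
      using less card_mono leD by blast
    then obtain w where w: "w \<in> source_seqs {..<D} (l a)" "\<And>b. b \<in> B \<Longrightarrow> w \<notin> E b" by auto
    have npre: "\<not> prefix (c b) w" if b: "b \<in> B" for b
    proof
      assume "prefix (c b) w"
      then obtain v where v: "w = c b @ v" by (auto simp: prefix_def)
      then have "v \<in> source_seqs {..<D} (l a - l b)"
        using w(1) c(2) b by (auto simp: source_seqs_def)
      then show False using w(2)[OF b] v by (auto simp: E_def)
    qed
    \<comment> \<open>By maximality of \<open>l a\<close>, a prefix relation in this direction is an
      equality, which \<open>npre\<close> rules out.\<close>
    have npre': "\<not> prefix w (c b)" if b: "b \<in> B" for b
    proof
      assume *: "prefix w (c b)"
      then have "length w \<le> length (c b)" by (rule prefix_length_le)
      then have "length w = length (c b)"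
        using w(1) c(2) b amax[of b] AB by (auto simp: source_seqs_def)
      then have "w = c b" using * by (auto simp: prefix_def)
      then show False using npre[OF b] by simp
    qed
    define c' where "c' = c(a := w)"
    have c'a: "c' a = w" by (simp add: c'_def)
    have c'B: "c' b = c b" if "b \<in> B" for b using that aB by (auto simp: c'_def)
    show ?case
    proof (intro exI conjI)
      show "c' \<in> A \<rightarrow> lists {..<D}"
        using c(1) w(1) c'a c'B AB by (auto simp: source_seqs_def Pi_def)
      show "\<forall>b\<in>A. length (c' b) = l b"
        using c(2) w(1) c'a c'B AB by (auto simp: source_seqs_def)
      show "prefix_free_on A c'"
        using c(3) npre npre' c'a c'B unfolding AB prefix_free_on_def by auto
    qed
  qed
  then show thesis using that by blast
qed


subsection \<open>The optimal real-valued lengths\<close>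

text \<open>The level comes from the intermediate value theorem on \<open>[0, 1]\<close>: level
  \<open>0\<close> changes nothing and gives a total of at most \<open>1\<close>, level
  \<open>1\<close> gives at least \<open>card S\<close>.\<close>

lemma waterfilling:
  fixes P :: "'b \<Rightarrow> real"
  assumes S: "finite S" "S \<noteq> {}" and P: "\<And>u. u \<in> S \<Longrightarrow> P u \<ge> 0" "(\<Sum>u\<in>S. P u) \<le> 1"
  obtains c where "(\<Sum>u\<in>S. max c (P u)) = 1"
proof -
  have "\<exists>c\<ge>0. c \<le> 1 \<and> (\<Sum>u\<in>S. max c (P u)) = 1"
  proof (rule IVT')
    show "(\<Sum>u\<in>S. max 0 (P u)) \<le> 1"
      using P by (simp add: max_def cong: sum.cong_simp)
    have "1 \<le> real (card S)" using S by (simp add: Suc_leI card_gt_0_iff)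
    also have "\<dots> = (\<Sum>u\<in>S. 1)" by simp
    also have "\<dots> \<le> (\<Sum>u\<in>S. max 1 (P u))" by (intro sum_mono) simp
    finally show "1 \<le> (\<Sum>u\<in>S. max 1 (P u))" .
    show "continuous_on {0..1} (\<lambda>c. \<Sum>u\<in>S. max c (P u))"
      by (intro continuous_intros)
  qed simp
  then show thesis using that by blast
qed

text \<open>Gibbs' inequality against a subprobability \<open>q\<close>, from
  \<open>ln x \<le> x - 1\<close> and its equality case \<open>x = 1\<close>. The first claim gives
  optimality of the lengths, the second their uniqueness, on which \<open>THE\<close> in
  \<open>opt_length\<close> relies.\<close>

lemma gibbs:
  fixes w q :: "'b \<Rightarrow> real"
  assumes S: "finite S" and w: "\<And>u. u \<in> S \<Longrightarrow> w u > 0" "(\<Sum>u\<in>S. w u) = 1"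
    and q: "\<And>u. u \<in> S \<Longrightarrow> q u > 0" "(\<Sum>u\<in>S. q u) \<le> 1"
    and D: "D > 1"
  shows "(\<Sum>u\<in>S. w u * log D (q u)) \<le> (\<Sum>u\<in>S. w u * log D (w u))"
    and "(\<Sum>u\<in>S. w u * log D (q u)) = (\<Sum>u\<in>S. w u * log D (w u)) \<Longrightarrow> u \<in> S \<Longrightarrow> q u = w u"
proof -
  \<comment> \<open>\<open>d u\<close> is the gap in \<open>ln x \<le> x - 1\<close> at
    \<open>x = q u / w u\<close>, scaled by \<open>w u\<close>. As \<open>q\<close> has no more
    total mass than \<open>w\<close>, the gaps sum to at most the relative entropy in natural
    units.\<close>
  define d where "d = (\<lambda>u. q u - w u - w u * (ln (q u) - ln (w u)))"
  have ln_q: "ln (q u) - ln (w u) = ln (q u / w u)" if "u \<in> S" for u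
    using w(1)[OF that] q(1)[OF that] by (simp add: ln_div)
  have d_eq: "d u = w u * (q u / w u - 1 - ln (q u / w u))" if "u \<in> S" for u
    using w(1)[OF that] ln_q[OF that] by (simp add: d_def field_simps)
  have d0: "d u \<ge> 0" if "u \<in> S" for u
    unfolding d_eq[OF that] using w(1)[OF that] q(1)[OF that] ln_le_minus_one[of "q u / w u"]
    by (intro mult_nonneg_nonneg) auto
  have lnD: "ln D > 0" using D by simp
  have diff: "(\<Sum>u\<in>S. w u * log D (w u)) - (\<Sum>u\<in>S. w u * log D (q u))
      = (- (\<Sum>u\<in>S. w u * (ln (q u) - ln (w u)))) / ln D"
    by (simp add: log_def sum_divide_distrib right_diff_distrib sum_subtractf diff_divide_distrib)
  have sum_d: "sum d S \<le> - (\<Sum>u\<in>S. w u * (ln (q u) - ln (w u)))"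
    using w(2) q(2) by (simp add: d_def sum_subtractf)
  have "sum d S \<ge> 0" using d0 by (rule sum_nonneg)
  then show "(\<Sum>u\<in>S. w u * log D (q u)) \<le> (\<Sum>u\<in>S. w u * log D (w u))"
    using diff sum_d lnD by (smt (verit) divide_nonneg_pos)
  assume eq: "(\<Sum>u\<in>S. w u * log D (q u)) = (\<Sum>u\<in>S. w u * log D (w u))" and u: "u \<in> S"
  have "sum d S \<le> 0" using diff sum_d lnD eq by simp
  then have "d u = 0"
    using sum_nonneg_eq_0_iff[OF S d0] \<open>sum d S \<ge> 0\<close> u by simp
  then have "ln (q u / w u) = q u / w u - 1"
    using d_eq[OF u] w(1)[OF u] by simp
  then have "q u / w u = 1"
    using w(1)[OF u] q(1)[OF u] by (intro ln_eq_minus_one) auto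
  then show "q u = w u" using w(1)[OF u] by simp
qed

lemma payoff_cong:
  assumes "\<And>u. u \<in> source_seqs X n \<Longrightarrow> l u = l' u"
  shows "payoff \<alpha> X p n l = payoff \<alpha> X p n l'"
  unfolding payoff_def using assms by (simp cong: sum.cong_simp image_cong_simp)

locale memoryless_source =
  fixes D :: nat and \<alpha> :: real and X :: "'a set" and p :: "'a \<Rightarrow> real"
  assumes D: "D \<ge> 2" and \<alpha>: "0 \<le> \<alpha>" "\<alpha> < 1"
    and X: "finite X" and p_pos: "\<And>x. x \<in> X \<Longrightarrow> p x > 0" and sum_p: "(\<Sum>x\<in>X. p x) = 1"
begin

lemma X_nonempty: "X \<noteq> {}"
  using sum_p by auto

text \<open>
  For any \<open>w\<close> of the form \<open>(1 - \<alpha>) p + \<alpha> q\<close> the payoff dominates the linear functional with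
  coefficients \<open>w\<close>. Choosing \<open>w\<close> by waterfilling concentrates \<open>q\<close> on the longest
  codewords of \<open>- log w\<close>, where the bound is attained.
\<close>

lemma optimal_lengths:
  obtains l where "l \<in> kraft_lengths D X n"
    "\<And>l'. l' \<in> kraft_lengths D X n \<Longrightarrow> payoff \<alpha> X p n l \<le> payoff \<alpha> X p n l'"
    "weight_entropy D \<alpha> X p n = payoff \<alpha> X p n l"
proof -
  define S where "S = source_seqs X n"
  define P where "P = (\<lambda>u. (1 - \<alpha>) * seq_prob p u)"
  have S: "finite S" "S \<noteq> {}"
    using X X_nonempty by (auto simp: S_def finite_source_seqs source_seqs_nonempty)
  have P_pos: "P u > 0" if "u \<in> S" for u
    using that seq_prob_pos[of X p u n] p_pos \<alpha> by (auto simp: P_def S_def)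
  have sum_P: "sum P S = 1 - \<alpha>"
    unfolding P_def S_def sum_distrib_left[symmetric] sum_seq_prob[OF sum_p] by simp
  have "\<exists>c. (\<Sum>u\<in>S. max c (P u)) = 1"
    using waterfilling[of S P] S P_pos sum_P \<alpha> by (metis diff_le_eq le_add_same_cancel1 less_imp_le)
  then obtain c where c: "(\<Sum>u\<in>S. max c (P u)) = 1" ..
  define w where "w = (\<lambda>u. max c (P u))"
  have sum_w: "sum w S = 1" using c by (simp add: w_def)
  have w_pos: "w u > 0" if "u \<in> S" for u using P_pos[OF that] by (simp add: w_def)
  have w_le_1: "w u \<le> 1" if "u \<in> S" for u
    using member_le_sum[of u S w] that S w_pos sum_w by (simp add: less_imp_le)
  \<comment> \<open>The restricted abstraction makes \<open>l\<close> extensional, as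
    \<open>kraft_lengths\<close> demands.\<close>
  define l where "l = (\<lambda>u\<in>S. - log D (w u))"
  have l_eq: "l u = - log D (w u)" if "u \<in> S" for u using that by (simp add: l_def)
  have powr_l: "real D powr (- l u) = w u" if "u \<in> S" for u
    using D w_pos[OF that] by (simp add: l_eq[OF that])
  have l_kraft: "l \<in> kraft_lengths D X n"
  proof -
    have "l \<in> S \<rightarrow>\<^sub>E {0..}"
      using D w_pos w_le_1 by (auto simp: l_def)
    moreover have "(\<Sum>u\<in>S. real D powr (- l u)) \<le> 1"
      using powr_l sum_w by simp
    ultimately show ?thesis by (simp add: kraft_lengths_def S_def)
  qed
  \<comment> \<open>The excesses \<open>w u - P u\<close> sum to \<alpha> and so distribute the
    maximum term over the sequences; the second sum measures how far the lengths stay below their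
    maximum.\<close>
  have payoff_eq: "payoff \<alpha> X p n l' =
      (\<Sum>u\<in>S. w u * l' u) + (\<Sum>u\<in>S. (w u - P u) * (Max (l' ` S) - l' u))" for l'
  proof -
    have "(\<Sum>u\<in>S. w u * l' u) + (\<Sum>u\<in>S. (w u - P u) * (Max (l' ` S) - l' u))
        = (\<Sum>u\<in>S. w u - P u) * Max (l' ` S) + (\<Sum>u\<in>S. P u * l' u)"
      unfolding sum_distrib_right sum.distrib[symmetric]
      by (rule sum.cong) (auto simp: algebra_simps)
    also have "(\<Sum>u\<in>S. w u - P u) = \<alpha>" using sum_w sum_P by (simp add: sum_subtractf)
    finally show ?thesis
      by (simp add: payoff_def S_def[symmetric] P_def sum_distrib_left algebra_simps)
  qed
  \<comment> \<open>\<open>c\<close> is a lower bound of \<open>w\<close>, so a sequence at the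
    water level has the greatest length.\<close>
  have max_l: "l u = Max (l ` S)" if "u \<in> S" "w u = c" for u
  proof -
    have "l v \<le> l u" if "v \<in> S" for v
      using that \<open>u \<in> S\<close> \<open>w u = c\<close> w_pos[OF \<open>u \<in> S\<close>] D by (auto simp: l_eq w_def)
    then have "Max (l ` S) = l u" using S that(1) by (intro Max_eqI) auto
    then show ?thesis by simp
  qed
  have w_cases: "w u = P u \<or> w u = c" for u by (auto simp: w_def max_def)
  \<comment> \<open>Complementary slackness: each sequence either carries no excess weight or
    attains the maximal length.\<close>
  have payoff_l: "payoff \<alpha> X p n l = (\<Sum>u\<in>S. w u * l u)"
  proof -
    have "(w u - P u) * (Max (l ` S) - l u) = 0" if "u \<in> S" for u
      using w_cases[of u] max_l[OF that] by auto
    then show ?thesis unfolding payoff_eq by (simp only: sum.neutral_const add_0_right cong: sum.cong)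
  qed
  have lower: "(\<Sum>u\<in>S. w u * l' u) \<le> payoff \<alpha> X p n l'" for l'
  proof -
    have "(w u - P u) * (Max (l' ` S) - l' u) \<ge> 0" if "u \<in> S" for u
      using S that by (intro mult_nonneg_nonneg) (auto simp: w_def)
    then show ?thesis by (simp add: payoff_eq sum_nonneg)
  qed
  have neg_sum: "(\<Sum>u\<in>S. w u * log D (real D powr (- l' u))) = - (\<Sum>u\<in>S. w u * l' u)" for l'
    using D by (simp add: sum_negf)
  have neg_sum_w: "(\<Sum>u\<in>S. w u * log D (w u)) = - (\<Sum>u\<in>S. w u * l u)"
    by (simp add: l_eq sum_negf)
  have l_min: "payoff \<alpha> X p n l \<le> payoff \<alpha> X p n l'"
    and l_unique: "payoff \<alpha> X p n l' \<le> payoff \<alpha> X p n l \<Longrightarrow> l' = l"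
    if l': "l' \<in> kraft_lengths D X n" for l'
  proof -
    have q: "\<And>u. u \<in> S \<Longrightarrow> real D powr (- l' u) > 0" "(\<Sum>u\<in>S. real D powr (- l' u)) \<le> 1"
      using l' D by (auto simp: kraft_lengths_def S_def)
    have D1: "real D > 1" using D by simp
    note g = gibbs[OF S(1) w_pos sum_w q D1]
    have le: "(\<Sum>u\<in>S. w u * l u) \<le> (\<Sum>u\<in>S. w u * l' u)"
      using g(1) neg_sum neg_sum_w by simp
    then show "payoff \<alpha> X p n l \<le> payoff \<alpha> X p n l'"
      using lower[of l'] payoff_l by simp
    \<comment> \<open>Now both Gibbs and \<open>lower\<close> are tight, and the equality case of
      Gibbs determines the lengths.\<close>
    assume "payoff \<alpha> X p n l' \<le> payoff \<alpha> X p n l"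
    then have "(\<Sum>u\<in>S. w u * l' u) = (\<Sum>u\<in>S. w u * l u)"
      using le lower[of l'] payoff_l by simp
    then have powr_l': "real D powr (- l' u) = w u" if "u \<in> S" for u
      using g(2)[OF _ _ _ that] neg_sum[of l'] neg_sum_w by simp
    have "l' u = l u" if "u \<in> S" for u
    proof -
      have "real D powr (- l' u) = real D powr (- l u)"
        using powr_l'[OF that] powr_l[OF that] by simp
      then show ?thesis using D by (simp add: powr_inj)
    qed
    then show "l' = l"
      using l' l_kraft by (auto simp: kraft_lengths_def S_def intro: PiE_ext)
  qed
  have opt: "opt_length D \<alpha> X p n = l"
    unfolding opt_length_def
  proof (rule the_equality)
    show "is_arg_min (payoff \<alpha> X p n) (\<lambda>l. l \<in> kraft_lengths D X n) l"
      using l_kraft l_min by (auto simp: is_arg_min_linorder)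
    show "l' = l" if "is_arg_min (payoff \<alpha> X p n) (\<lambda>l. l \<in> kraft_lengths D X n) l'" for l'
      using that l_kraft l_unique by (auto simp: is_arg_min_linorder)
  qed
  define U where "U = {u \<in> S. l u = Max (l ` S)}"
  have U: "max_length_seqs D \<alpha> X p n = U"
    by (simp add: max_length_seqs_def opt U_def S_def)
  have "Max (l ` S) \<in> l ` S" using S by (intro Max_in) auto
  then have "U \<noteq> {}" by (auto simp: U_def)
  moreover have US: "U \<subseteq> S" "finite U" using S by (auto simp: U_def)
  ultimately have cardU: "real (card U) > 0" by (simp add: card_gt_0_iff)
  have w_out: "w u = P u" if "u \<in> S - U" for u
    using that w_cases[of u] max_l[of u] by (auto simp: U_def)
  \<comment> \<open>On \<open>U\<close> the lengths are constant, hence so is \<open>w\<close>. Its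
    value is the mass left over by \<open>S - U\<close>, where \<open>w\<close> agrees with
    \<open>P\<close>, shared equally among the members of \<open>U\<close>.\<close>
  have weight_eq: "weight D \<alpha> X p n u = w u" if u: "u \<in> S" for u
  proof (cases "u \<in> U")
    case False
    then show ?thesis using w_out u by (simp add: weight_def U P_def)
  next
    case True
    have "w v = w u" if "v \<in> U" for v
      using that True powr_l[of u] powr_l[of v] by (simp add: U_def)
    then have "card U * w u = sum w U" by simp
    also have "\<dots> = 1 - sum w (S - U)"
      using sum.subset_diff[OF US(1) S(1), of w] sum_w by simp
    also have "sum w (S - U) = sum P (S - U)" using w_out by (intro sum.cong) auto
    also have "1 - \<dots> = \<alpha> + sum P U"
      using sum.subset_diff[OF US(1) S(1), of P] sum_P by simp
    finally show ?thesis
      using True cardU by (simp add: weight_def U P_def sum_distrib_left field_simps)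
  qed
  have "weight_entropy D \<alpha> X p n = payoff \<alpha> X p n l"
    unfolding weight_entropy_def S_def[symmetric] payoff_l
    using weight_eq neg_sum_w by simp
  then show thesis using that l_kraft l_min by blast
qed

section \<open>Consequences of minimality: bounds, subadditivity and codes\<close>

lemma weight_entropy_le_payoff:
  assumes "\<And>u. u \<in> source_seqs X n \<Longrightarrow> l u \<ge> 0"
    and "(\<Sum>u\<in>source_seqs X n. real D powr (- l u)) \<le> 1"
  shows "weight_entropy D \<alpha> X p n \<le> payoff \<alpha> X p n l"
proof -
  \<comment> \<open>Restriction supplies extensionality and leaves the payoff unchanged, which only
    sees values on source sequences.\<close>
  define l' where "l' = restrict l (source_seqs X n)"
  have "l' \<in> kraft_lengths D X n"
    using assms by (auto simp: kraft_lengths_def l'_def)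
  then have "weight_entropy D \<alpha> X p n \<le> payoff \<alpha> X p n l'"
    by (metis optimal_lengths)
  also have "\<dots> = payoff \<alpha> X p n l" by (rule payoff_cong) (simp add: l'_def)
  finally show ?thesis .
qed

text \<open>Provides the lower bound that Fekete's lemma asks for.\<close>

lemma weight_entropy_nonneg: "weight_entropy D \<alpha> X p n \<ge> 0"
proof -
  obtain l where l: "l \<in> kraft_lengths D X n" "weight_entropy D \<alpha> X p n = payoff \<alpha> X p n l"
    using optimal_lengths by blast
  obtain u where u: "u \<in> source_seqs X n" using source_seqs_nonempty[OF X_nonempty] by blast
  have l0: "l v \<ge> 0" if "v \<in> source_seqs X n" for v
    using that l(1) by (auto simp: kraft_lengths_def)
  have "0 \<le> l u" using l0[OF u] .
  also have "l u \<le> Max (l ` source_seqs X n)"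
    using u X by (intro Max_ge) (auto simp: finite_source_seqs)
  finally have "Max (l ` source_seqs X n) \<ge> 0" .
  moreover have "(\<Sum>u\<in>source_seqs X n. l u * seq_prob p u) \<ge> 0"
    using l0 p_pos seq_prob_pos[of X p _ n]
    by (intro sum_nonneg mult_nonneg_nonneg) (auto intro: less_imp_le)
  ultimately show ?thesis using \<alpha> by (simp add: l(2) payoff_def)
qed

text \<open>Adding optimal lengths of the two blocks gives admissible lengths for their concatenation.\<close>

lemma weight_entropy_subadditive:
  "weight_entropy D \<alpha> X p (m + n) \<le> weight_entropy D \<alpha> X p m + weight_entropy D \<alpha> X p n"
proof -
  obtain f where f: "f \<in> kraft_lengths D X m" "weight_entropy D \<alpha> X p m = payoff \<alpha> X p m f"
    using optimal_lengths by blast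
  obtain g where g: "g \<in> kraft_lengths D X n" "weight_entropy D \<alpha> X p n = payoff \<alpha> X p n g"
    using optimal_lengths by blast
  let ?S = "source_seqs X m" and ?T = "source_seqs X n" and ?R = "source_seqs X (m + n)"
  define h where "h = (\<lambda>w. f (take m w) + g (drop m w))"
  have R: "take m w \<in> ?S" "drop m w \<in> ?T" if "w \<in> ?R" for w
    using that by (auto simp: source_seqs_def lists_eq_set dest: in_set_takeD in_set_dropD)
  have h: "h (u @ v) = f u + g v" if "u \<in> ?S" for u v
    using that by (simp add: h_def source_seqs_def)
  have fin: "finite ?S" "finite ?T" "finite ?R" using X by (auto simp: finite_source_seqs)
  have f0: "\<And>u. u \<in> ?S \<Longrightarrow> f u \<ge> 0" and g0: "\<And>v. v \<in> ?T \<Longrightarrow> g v \<ge> 0"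
    using f(1) g(1) by (auto simp: kraft_lengths_def)
  have "weight_entropy D \<alpha> X p (m + n) \<le> payoff \<alpha> X p (m + n) h"
  proof (rule weight_entropy_le_payoff)
    show "h w \<ge> 0" if "w \<in> ?R" for w using R[OF that] f0 g0 by (simp add: h_def)
    \<comment> \<open>The Kraft sum of the concatenation factors into those of the two
      blocks.\<close>
    have "(\<Sum>w\<in>?R. real D powr (- h w))
        = (\<Sum>u\<in>?S. \<Sum>v\<in>?T. real D powr (- f u) * real D powr (- g v))"
      unfolding sum_source_seqs_add by (intro sum.cong) (auto simp: h powr_add[symmetric])
    also have "\<dots> = (\<Sum>u\<in>?S. real D powr (- f u)) * (\<Sum>v\<in>?T. real D powr (- g v))"
      by (simp add: sum_product)
    also have "\<dots> \<le> 1 * 1"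
      using f(1) g(1) by (intro mult_mono) (auto simp: kraft_lengths_def sum_nonneg)
    finally show "(\<Sum>w\<in>?R. real D powr (- h w)) \<le> 1" by simp
  qed
  also have "payoff \<alpha> X p (m + n) h \<le> payoff \<alpha> X p m f + payoff \<alpha> X p n g"
  proof -
    have "Max (h ` ?R) \<le> Max (f ` ?S) + Max (g ` ?T)"
    proof (rule Max.boundedI)
      show "finite (h ` ?R)" using fin by simp
      show "h ` ?R \<noteq> {}" using source_seqs_nonempty[OF X_nonempty] by simp
      fix z assume "z \<in> h ` ?R"
      then obtain w where w: "w \<in> ?R" "z = h w" by auto
      show "z \<le> Max (f ` ?S) + Max (g ` ?T)"
        unfolding w(2) h_def using R[OF w(1)] fin by (intro add_mono Max_ge) auto
    qed
    then have max: "\<alpha> * Max (h ` ?R) \<le> \<alpha> * (Max (f ` ?S) + Max (g ` ?T))"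
      using \<alpha> by (intro mult_left_mono)
    have sums: "(\<Sum>u\<in>?S. seq_prob p u) = 1" "(\<Sum>v\<in>?T. seq_prob p v) = 1"
      using sum_seq_prob[OF sum_p] by auto
    \<comment> \<open>Independence: block probabilities multiply, so mean lengths add.\<close>
    have "(\<Sum>w\<in>?R. h w * seq_prob p w)
        = (\<Sum>u\<in>?S. \<Sum>v\<in>?T. (f u * seq_prob p u) * seq_prob p v
              + seq_prob p u * (g v * seq_prob p v))"
      unfolding sum_source_seqs_add
      by (intro sum.cong) (auto simp: h seq_prob_append algebra_simps)
    also have "\<dots> = (\<Sum>u\<in>?S. f u * seq_prob p u) * (\<Sum>v\<in>?T. seq_prob p v)
        + (\<Sum>u\<in>?S. seq_prob p u) * (\<Sum>v\<in>?T. g v * seq_prob p v)"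
      unfolding sum_product by (simp add: sum.distrib)
    finally have "(\<Sum>w\<in>?R. h w * seq_prob p w)
        = (\<Sum>u\<in>?S. f u * seq_prob p u) + (\<Sum>v\<in>?T. g v * seq_prob p v)"
      by (simp add: sums)
    then show ?thesis using max by (simp add: payoff_def algebra_simps)
  qed
  finally show ?thesis using f(2) g(2) by simp
qed

text \<open>By McMillan, codeword lengths compete in the minimization whose minimum is the weight
  entropy.\<close>

lemma weight_entropy_le_payoff_code:
  assumes "uniquely_decodable D (source_seqs X n) c"
  shows "weight_entropy D \<alpha> X p n \<le> payoff \<alpha> X p n (\<lambda>u. real (length (c u)))"
proof (rule weight_entropy_le_payoff)
  have "(\<Sum>u\<in>source_seqs X n. real D powr - real (length (c u)))
      = (\<Sum>u\<in>source_seqs X n. (1 / real D) ^ length (c u))"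
    using D by (simp add: powr_minus powr_realpow power_divide divide_inverse power_inverse)
  also have "\<dots> \<le> 1"
    using D X assms by (intro kraft_mcmillan) (auto simp: finite_source_seqs)
  finally show "(\<Sum>u\<in>source_seqs X n. real D powr - real (length (c u))) \<le> 1" .
qed simp

text \<open>
  Lengths are rounded up and then increased by one, so that codewords are nonempty even when
  there is only one source sequence.
\<close>

lemma exists_code_payoff_le:
  "\<exists>c. uniquely_decodable D (source_seqs X n) c \<and>
    payoff \<alpha> X p n (\<lambda>u. real (length (c u))) \<le> weight_entropy D \<alpha> X p n + 2"
proof -
  obtain l where l: "l \<in> kraft_lengths D X n" "weight_entropy D \<alpha> X p n = payoff \<alpha> X p n l"
    using optimal_lengths by blast
  let ?S = "source_seqs X n"
  define L where "L = (\<lambda>u. nat \<lceil>l u\<rceil> + 1)"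
  have l0: "l u \<ge> 0" if "u \<in> ?S" for u using that l(1) by (auto simp: kraft_lengths_def)
  \<comment> \<open>At most one unit is lost by rounding up, another by the increment.\<close>
  have L: "l u \<le> real (L u)" "real (L u) \<le> l u + 2" if "u \<in> ?S" for u
    using l0[OF that] unfolding L_def by linarith+
  have fin: "finite ?S" using X by (rule finite_source_seqs)
  have "(\<Sum>u\<in>?S. (1 / real D) ^ L u) = (\<Sum>u\<in>?S. real D powr (- real (L u)))"
    using D by (simp add: powr_minus powr_realpow power_divide divide_inverse power_inverse)
  also have "\<dots> \<le> (\<Sum>u\<in>?S. real D powr (- l u))"
    using D L by (intro sum_mono) simp
  also have "\<dots> \<le> 1" using l(1) by (simp add: kraft_lengths_def)
  finally obtain c where c: "c \<in> ?S \<rightarrow> lists {..<D}" "\<And>u. u \<in> ?S \<Longrightarrow> length (c u) = L u"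
    "prefix_free_on ?S c"
    using kraft_converse[of D ?S L] D fin by auto
  have "c u \<noteq> []" if "u \<in> ?S" for u using c(2)[OF that] by (auto simp: L_def)
  then have "uniquely_decodable D ?S c"
    using c by (intro uniquely_decodable_if_prefix_free) auto
  moreover have "payoff \<alpha> X p n (\<lambda>u. real (length (c u))) \<le> payoff \<alpha> X p n l + 2"
  proof -
    have "payoff \<alpha> X p n (\<lambda>u. real (length (c u))) = payoff \<alpha> X p n (\<lambda>u. real (L u))"
      by (rule payoff_cong) (simp add: c(2))
    \<comment> \<open>Raising all lengths by \<open>2\<close> raises maximum and mean by
      \<open>2\<close>, and their weights \<alpha> and \<open>1 - \<alpha>\<close> sum to
      one.\<close>
    also have "\<dots> \<le> \<alpha> * (Max (l ` ?S) + 2) + (1 - \<alpha>) * (\<Sum>u\<in>?S. (l u + 2) * seq_prob p u)"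
      unfolding payoff_def
    proof (intro add_mono mult_left_mono sum_mono mult_right_mono)
      show "Max ((\<lambda>u. real (L u)) ` ?S) \<le> Max (l ` ?S) + 2"
      proof (rule Max.boundedI)
        fix z assume "z \<in> (\<lambda>u. real (L u)) ` ?S"
        then obtain u where u: "u \<in> ?S" "z = real (L u)" by auto
        have "l u \<le> Max (l ` ?S)" using u fin by (intro Max_ge) auto
        then show "z \<le> Max (l ` ?S) + 2" using L(2)[OF u(1)] u(2) by linarith
      qed (use fin source_seqs_nonempty[OF X_nonempty] in auto)
      show "0 \<le> seq_prob p u" if "u \<in> ?S" for u
        using seq_prob_pos[of X p u n] p_pos that by (auto intro: less_imp_le)
    qed (use \<alpha> L in auto)
    also have "(\<Sum>u\<in>?S. (l u + 2) * seq_prob p u)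
        = (\<Sum>u\<in>?S. l u * seq_prob p u) + 2 * (\<Sum>u\<in>?S. seq_prob p u)"
      by (simp add: distrib_right sum.distrib sum_distrib_left)
    also have "(\<Sum>u\<in>?S. seq_prob p u) = 1" by (rule sum_seq_prob[OF sum_p])
    finally show ?thesis by (simp add: payoff_def algebra_simps)
  qed
  ultimately show ?thesis using l(2) by auto
qed

end


subsection \<open>Fekete's lemma\<close>

text \<open>The form suited to dividing a block length by \<open>m\<close> with remainder
  \<open>r\<close>.\<close>

lemma subadditive_mult:
  fixes a :: "nat \<Rightarrow> real"
  assumes "\<And>m n. a (m + n) \<le> a m + a n"
  shows "a (q * m + r) \<le> real q * a m + a r"
proof (induction q)
  case (Suc q)
  have "a (Suc q * m + r) \<le> a m + a (q * m + r)"
    using assms[of m "q * m + r"] by (simp add: add.assoc)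
  then show ?case using Suc by (simp add: algebra_simps)
qed simp

text \<open>Dividing \<open>n\<close> by an \<open>m\<close> whose ratio is nearly the infimum gives
  \<open>a n / n \<le> a m / m + B / n\<close>, where \<open>B\<close> bounds \<open>a\<close> on
  the finitely many remainders. Nonnegativity bounds the ratios below.\<close>

theorem fekete:
  fixes a :: "nat \<Rightarrow> real"
  assumes sub: "\<And>m n. a (m + n) \<le> a m + a n" and nonneg: "\<And>n. a n \<ge> 0"
  shows "(\<lambda>n. a n / real n) \<longlonglongrightarrow> (INF n\<in>{1..}. a n / real n)"
proof (rule LIMSEQ_I)
  fix e :: real assume e: "e > 0"
  define I where "I = (INF n\<in>{1..}. a n / real n)"
  have bdd: "bdd_below ((\<lambda>n. a n / real n) ` {1..})"
    using nonneg by (intro bdd_belowI[of _ 0]) auto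
  have I_le: "I \<le> a n / real n" if "n \<ge> 1" for n
    unfolding I_def using that by (intro cINF_lower[OF bdd]) auto
  have "\<exists>m\<in>{1..}. a m / real m < I + e / 2"
    using e cINF_less_iff[OF _ bdd, of "I + e / 2"] by (auto simp: I_def)
  then obtain m where m: "m \<ge> 1" "a m / real m < I + e / 2" by auto
  define B where "B = Max (a ` {..<m})"
  have B: "a r \<le> B" if "r < m" for r unfolding B_def using that by (intro Max_ge) auto
  \<comment> \<open>Beyond \<open>N\<close> the remainder term \<open>B / n\<close> is below
    \<open>e / 2\<close>; the other half of \<open>e\<close> was spent on the choice of
    \<open>m\<close>.\<close>
  obtain N where N: "real N > 2 * B / e" using reals_Archimedean2 by blast
  have "norm (a n / real n - I) < e" if n: "n \<ge> max 1 N" for n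
  proof -
    have n0: "real n > 0" using n by simp
    have "a n \<le> real (n div m) * a m + a (n mod m)"
      using subadditive_mult[of a "n div m" m "n mod m", OF sub] by simp
    \<comment> \<open>Passing from \<open>n div m\<close> to the real quotient uses
      \<open>a m \<ge> 0\<close>.\<close>
    also have "\<dots> \<le> (real n / real m) * a m + B"
      using m(1) nonneg[of m] B[of "n mod m"]
      by (intro add_mono mult_right_mono) (auto simp: of_nat_div_le_of_nat)
    finally have "a n / real n \<le> a m / real m + B / real n"
      using n0 by (simp add: field_simps)
    moreover have "B / real n < e / 2"
    proof -
      have "2 * B / e < real n" using N n by simp
      then show ?thesis using e n0 by (simp add: field_simps)
    qed
    ultimately have "a n / real n < I + e" using m(2) by linarith
    then show ?thesis using I_le[of n] n by simp
  qed
  then show "\<exists>N. \<forall>n\<ge>N. norm (a n / real n - (INF n\<in>{1..}. a n / real n)) < e"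
    unfolding I_def by blast
qed

text \<open>The limit is an infimum, so it lies below every term; this gives the converse part of
  the coding theorem at every block length, not just asymptotically.\<close>

lemma fekete_lim_le:
  fixes a :: "nat \<Rightarrow> real"
  assumes sub: "\<And>m n. a (m + n) \<le> a m + a n" and nonneg: "\<And>n. a n \<ge> 0" and n: "n \<ge> 1"
  shows "lim (\<lambda>n. a n / real n) \<le> a n / real n"
  unfolding limI[OF fekete[of a, OF sub nonneg]]
  using nonneg n by (intro cINF_lower bdd_belowI[of _ 0]) auto

section \<open>The coding theorem for block encodings\<close>

theorem theorem3:
  fixes D :: nat and \<alpha> :: real and xs :: "'a list" and p :: "'a \<Rightarrow> real"
  assumes "D \<ge> 2"
    and "distinct xs"
    and "p \<in> prob_vectors xs"
    and "0 \<le> \<alpha>" and "\<alpha> < 1"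
  shows "convergent (\<lambda>n. weight_entropy D \<alpha> (set xs) p n / real n)
    \<and> (\<forall>\<epsilon>>0. \<exists>N. \<forall>n\<ge>N. \<exists>c. uniquely_decodable D (source_seqs (set xs) n) c \<and>
         \<bar>payoff \<alpha> (set xs) p n (\<lambda>u. real (length (c u))) / real n
            - entropy_rate D \<alpha> (set xs) p\<bar> < \<epsilon>)
    \<and> (\<forall>n\<ge>1. \<forall>c. uniquely_decodable D (source_seqs (set xs) n) c \<longrightarrow>
         payoff \<alpha> (set xs) p n (\<lambda>u. real (length (c u))) / real n
            \<ge> entropy_rate D \<alpha> (set xs) p)"
proof -
  interpret memoryless_source D \<alpha> "set xs" p
    using assms by unfold_locales (auto simp: prob_vectors_def)
  let ?a = "weight_entropy D \<alpha> (set xs) p" and ?H = "entropy_rate D \<alpha> (set xs) p"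
  let ?L = "\<lambda>n c. payoff \<alpha> (set xs) p n (\<lambda>u. real (length (c u)))"
  \<comment> \<open>Convergence ensures that the \<open>lim\<close> in \<open>entropy_rate\<close>
    is a genuine limit.\<close>
  have conv: "convergent (\<lambda>n. ?a n / real n)"
    using fekete[of ?a, OF weight_entropy_subadditive weight_entropy_nonneg]
    by (auto simp: convergent_def)
  have H_le: "?H \<le> ?a n / real n" if "n \<ge> 1" for n
    unfolding entropy_rate_def
    using fekete_lim_le[of ?a, OF weight_entropy_subadditive weight_entropy_nonneg that] .
  have lower: "?H \<le> ?L n c / real n"
    if "n \<ge> 1" "uniquely_decodable D (source_seqs (set xs) n) c" for n c
    using H_le[OF that(1)] divide_right_mono[OF weight_entropy_le_payoff_code[OF that(2)], of "real n"]
    by simp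
  have upper: "\<exists>N. \<forall>n\<ge>N. \<exists>c. uniquely_decodable D (source_seqs (set xs) n) c \<and>
      \<bar>?L n c / real n - ?H\<bar> < e" if e: "e > 0" for e
  proof -
    \<comment> \<open>The constant overhead of \<open>2\<close> per block vanishes per
      symbol.\<close>
    have "(\<lambda>n. ?a n / real n + 2 / real n) \<longlonglongrightarrow> ?H + 0"
      using conv unfolding entropy_rate_def convergent_LIMSEQ_iff
      by (intro tendsto_add lim_const_over_n)
    then have "\<forall>\<^sub>F n in sequentially. ?a n / real n + 2 / real n < ?H + e"
      using e by (intro order_tendstoD(2)[of _ "?H + 0"]) auto
    then obtain N where N: "\<And>n. n \<ge> N \<Longrightarrow> ?a n / real n + 2 / real n < ?H + e"
      by (auto simp: eventually_sequentially)
    \<comment> \<open>Starting at \<open>max 1 N\<close> keeps the block length positive, as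
      \<open>lower\<close> requires.\<close>
    have "\<exists>c. uniquely_decodable D (source_seqs (set xs) n) c \<and> \<bar>?L n c / real n - ?H\<bar> < e"
      if n: "n \<ge> max 1 N" for n
    proof -
      obtain c where c: "uniquely_decodable D (source_seqs (set xs) n) c" "?L n c \<le> ?a n + 2"
        using exists_code_payoff_le[of n] by blast
      have "?L n c / real n \<le> ?a n / real n + 2 / real n"
        using divide_right_mono[OF c(2), of "real n"] by (simp add: add_divide_distrib)
      then have "\<bar>?L n c / real n - ?H\<bar> < e"
        using N[of n] n lower[OF _ c(1)] by simp
      then show ?thesis using c(1) by blast
    qed
    then show ?thesis by blast
  qed
  show ?thesis using conv upper lower by blast
qed

end
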